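(* Let $I\subset\mathbb{R}$ be a nonempty open interval and let $\psi:I\to E^3$ be a unit speed analytic curve whose curvature is not identically zero, with unit tangent $T=\psi'$. Then $\psi$ is a general helix if and only if $$\det(T',T'',T''')=0$$ at every point of $I$.
   Context: $E^3$ is Euclidean 3-space with its standard inner product $\langle\cdot,\cdot\rangle$; primes denote derivatives with respect to the arc length $s$. The curvature is $\kappa=\|\psi''\|$. A general helix is a curve whose unit tangent $T$ makes a constant angle with a fixed direction, i.e. there is a fixed unit vector $u$ with $\langle T,u\rangle$ constant. ($T$ is the first vector of the modified orthogonal frame $T=\psi'$, $N=T'$, $B=T\times N$.) *)

theory Defs
  imports "HOL-Analysis.Analysis"
begin

text \<open>
  A curve is a total function on the reals of which only the values on a set \<open>I\<close> matter.
  When \<open>I\<close> is open, all derivatives at points of \<open>I\<close> depend only on the restriction to \<open>I\<close>.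
\<close>

definition vderiv :: "(real \<Rightarrow> 'a::real_normed_vector) \<Rightarrow> real \<Rightarrow> 'a" where
  "vderiv f s = vector_derivative f (at s)"

text \<open>
  Real analyticity: \<open>f\<close> is the sum of a convergent power series, with vector coefficients,
  around each point of \<open>I\<close>.  (The library's \<open>analytic_on\<close> is complex analyticity.)
\<close>

definition real_analytic_on :: "(real \<Rightarrow> 'a::real_normed_vector) \<Rightarrow> real set \<Rightarrow> bool" where
  "real_analytic_on f I \<longleftrightarrow>
     (\<forall>s0\<in>I. \<exists>r>0. \<exists>a::nat \<Rightarrow> 'a.
        \<forall>s\<in>I. \<bar>s - s0\<bar> < r \<longrightarrow> (\<lambda>n. (s - s0) ^ n *\<^sub>R a n) sums f s)"

definition unit_speed_on :: "(real \<Rightarrow> real^3) \<Rightarrow> real set \<Rightarrow> bool" where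
  "unit_speed_on \<psi> I \<longleftrightarrow> (\<forall>s\<in>I. \<psi> differentiable at s \<and> norm (vderiv \<psi> s) = 1)"

definition tangent :: "(real \<Rightarrow> real^3) \<Rightarrow> real \<Rightarrow> real^3" where
  "tangent \<psi> = vderiv \<psi>"

text \<open>Curvature of a curve parametrized by arc length.\<close>

definition curvature :: "(real \<Rightarrow> real^3) \<Rightarrow> real \<Rightarrow> real" where
  "curvature \<psi> s = norm (vderiv (vderiv \<psi>) s)"

definition general_helix_on :: "(real \<Rightarrow> real^3) \<Rightarrow> real set \<Rightarrow> bool" where
  "general_helix_on \<psi> I \<longleftrightarrow>
     (\<exists>u c. norm u = 1 \<and> (\<forall>s\<in>I. tangent \<psi> s \<bullet> u = c))"

end

theory Submission
  imports Defs "HOL-Complex_Analysis.Cauchy_Integral_Formula"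
begin

text \<open>
  With \<open>N = T'\<close>, being a helix means that the values of \<open>N\<close> lie in a fixed plane \<open>u\<^sup>\<bottom>\<close>,
  and the determinant is the Wronskian of the components of \<open>N\<close>.  If it vanishes, then
  \<open>M = N \<times> N'\<close> satisfies \<open>M \<times> M' = det (N, N', N'') N = 0\<close>, so \<open>M\<close> keeps its direction \<open>u\<close>
  near any point where it is nonzero, and \<open>N\<close> is orthogonal to \<open>u\<close> there.  If \<open>M\<close> vanishes
  identically, then \<open>N\<close> itself keeps its direction near any point where it is nonzero, and any
  \<open>u\<close> orthogonal to that direction works.  In both cases \<open>N \<bullet> u\<close> vanishes near a point,
  hence on all of \<open>I\<close> by analyticity.
\<close>

unbundle cross3_syntax

section \<open>Power series expansions and termwise differentiation\<close>

text \<open>The definition constrains \<open>f\<close> only at points of \<open>I\<close>. Shrinking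
  the radius until the ball lies inside \<open>I\<close> gives an expansion on a full neighbourhood,
  as termwise differentiation requires.\<close>

lemma real_analytic_on_expansion:
  assumes "open I" "real_analytic_on f I" "s0 \<in> I"
  obtains r a where "r > 0"
    "\<And>x. \<bar>x\<bar> < r \<Longrightarrow> (\<lambda>n. x ^ n *\<^sub>R a n) sums f (s0 + x)"
proof -
  obtain e where e: "e > 0" "ball s0 e \<subseteq> I"
    using assms openE by blast
  obtain r a where r: "r > 0"
    and a: "\<forall>s\<in>I. \<bar>s - s0\<bar> < r \<longrightarrow> (\<lambda>n. (s - s0) ^ n *\<^sub>R a n) sums f s"
    using assms(2,3) unfolding real_analytic_on_def by blast
  show thesis
  proof (rule that[of "min e r" a])
    fix x :: real
    assume "\<bar>x\<bar> < min e r"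
    then have "s0 + x \<in> I" "\<bar>x\<bar> < r"
      using e by (auto simp: dist_real_def subset_iff)
    then show "(\<lambda>n. x ^ n *\<^sub>R a n) sums f (s0 + x)"
      using a[rule_format, of "s0 + x"] by simp
  qed (use e r in auto)
qed

text \<open>Termwise differentiation of scalar series is applied to each coordinate
  \<open>c b\<close>, and \<open>D\<close> reassembles the results. The second conclusion, a series
  for \<open>D\<close>, is what makes the derivative analytic again.\<close>

lemma vector_powser_has_vector_derivative:
  fixes g :: "real \<Rightarrow> 'a::euclidean_space"
  assumes g: "\<And>x. \<bar>x\<bar> < r \<Longrightarrow> (\<lambda>n. x ^ n *\<^sub>R a n) sums g x" and x: "\<bar>x\<bar> < r"
  obtains D where "(g has_vector_derivative D) (at x)"
    "(\<lambda>n. x ^ n *\<^sub>R (real (Suc n) *\<^sub>R a (Suc n))) sums D"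
proof -
  define c where "c b n = a n \<bullet> b" for b n
  define S where "S b = (\<Sum>n. diffs (c b) n * x ^ n)" for b
  define D where "D = (\<Sum>b\<in>Basis. S b *\<^sub>R b)"
  have c: "(\<lambda>n. c b n * z ^ n) sums (g z \<bullet> b)" if "\<bar>z\<bar> < r" for b z
    using bounded_linear.sums[OF bounded_linear_inner_left g[OF that], of b]
    by (simp add: c_def mult.commute)
  have S: "(\<lambda>n. diffs (c b) n * x ^ n) sums S b" for b
    unfolding S_def
    by (intro summable_sums termdiff_converges[of x r])
      (use x c sums_summable in \<open>auto simp: real_norm_def\<close>)
  have der: "((\<lambda>z. g z \<bullet> b) has_field_derivative S b) (at x)" for b
  proof -
    have "((\<lambda>z. \<Sum>n. c b n * z ^ n) has_field_derivative S b) (at x)"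
      unfolding S_def
      by (rule termdiffs_strong'[of r]) (use x c sums_summable in \<open>auto simp: real_norm_def\<close>)
    then show ?thesis
      by (rule has_field_derivative_transform_within_open[of _ _ _ "ball 0 r"])
        (use x c in \<open>auto simp: dist_real_def sums_iff\<close>)
  qed
  have DS: "D \<bullet> b = S b" if "b \<in> Basis" for b
    using that by (simp add: D_def inner_sum_left_Basis)
  have "(g has_vector_derivative D) (at x)"
    unfolding has_vector_derivative_def
    by (subst has_derivative_componentwise_within)
      (use der in \<open>auto simp: DS has_field_derivative_def mult.commute[of _ "S _"]\<close>)
  moreover have "(\<lambda>n. x ^ n *\<^sub>R (real (Suc n) *\<^sub>R a (Suc n))) sums D"
  proof -
    have "(\<lambda>n. \<Sum>b\<in>Basis. (diffs (c b) n * x ^ n) *\<^sub>R b) sums D"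
      unfolding D_def
      by (intro sums_sum bounded_linear.sums[OF bounded_linear_scaleR_left] S)
    \<comment> \<open>Summing the differentiated coordinate series over the basis recovers the
      vector coefficients; \<open>diffs\<close> supplies the factor \<open>Suc n\<close> and the
      index shift.\<close>
    moreover have "(\<Sum>b\<in>Basis. (diffs (c b) n * x ^ n) *\<^sub>R b)
        = x ^ n *\<^sub>R (real (Suc n) *\<^sub>R a (Suc n))" for n
      by (subst euclidean_representation[symmetric, of "x ^ n *\<^sub>R (real (Suc n) *\<^sub>R a (Suc n))"])
        (auto simp: diffs_def c_def mult_ac intro!: sum.cong)
    ultimately show ?thesis by simp
  qed
  ultimately show thesis by (rule that)
qed

text \<open>Both claims come from one local fact: on a whole ball around \<open>s0\<close> the
  derivative exists and is the sum of a single power series. Taking \<open>s = s0\<close> gives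
  differentiability, the ball gives analyticity.\<close>

lemma
  fixes f :: "real \<Rightarrow> 'a::euclidean_space"
  assumes I: "open I" and f: "real_analytic_on f I"
  shows real_analytic_on_has_vector_derivative:
      "\<And>s. s \<in> I \<Longrightarrow> (f has_vector_derivative vderiv f s) (at s)"
    and real_analytic_on_vderiv: "real_analytic_on (vderiv f) I"
proof -
  have *: "\<exists>r>0. \<exists>a. \<forall>s. \<bar>s - s0\<bar> < r \<longrightarrow>
      (f has_vector_derivative vderiv f s) (at s) \<and> (\<lambda>n. (s - s0) ^ n *\<^sub>R a n) sums vderiv f s"
    if "s0 \<in> I" for s0
  proof -
    obtain r a where r: "r > 0"
      and a: "\<And>x. \<bar>x\<bar> < r \<Longrightarrow> (\<lambda>n. x ^ n *\<^sub>R a n) sums f (s0 + x)"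
      using real_analytic_on_expansion[OF I f \<open>s0 \<in> I\<close>] by metis
    have "(f has_vector_derivative vderiv f s) (at s) \<and>
        (\<lambda>n. (s - s0) ^ n *\<^sub>R (real (Suc n) *\<^sub>R a (Suc n))) sums vderiv f s"
      if "\<bar>s - s0\<bar> < r" for s
    proof -
      obtain D where D: "((\<lambda>x. f (s0 + x)) has_vector_derivative D) (at (s - s0))"
          "(\<lambda>n. (s - s0) ^ n *\<^sub>R (real (Suc n) *\<^sub>R a (Suc n))) sums D"
        using vector_powser_has_vector_derivative[OF a \<open>\<bar>s - s0\<bar> < r\<close>] by blast
      have "((\<lambda>s. s - s0) has_vector_derivative 1) (at s)"
        by (auto intro!: derivative_eq_intros)
      from vector_diff_chain_at[OF this D(1)]
      have "(f has_vector_derivative D) (at s)"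
        by (simp add: o_def)
      then show ?thesis
        using D(2) by (simp add: vderiv_def vector_derivative_at)
    qed
    then show ?thesis
      using r by (intro exI[of _ r] conjI exI[of _ "\<lambda>n. real (Suc n) *\<^sub>R a (Suc n)"]) auto
  qed
  show "\<And>s. s \<in> I \<Longrightarrow> (f has_vector_derivative vderiv f s) (at s)"
    using * by (metis abs_zero diff_self)
  show "real_analytic_on (vderiv f) I"
    unfolding real_analytic_on_def
  proof
    fix s0 assume "s0 \<in> I"
    from *[OF this] show "\<exists>r>0. \<exists>a. \<forall>s\<in>I. \<bar>s - s0\<bar> < r \<longrightarrow>
        (\<lambda>n. (s - s0) ^ n *\<^sub>R a n) sums vderiv f s"
      by (elim ex_forward conj_forward) auto
  qed
qed

lemma real_analytic_on_inner:
  fixes f :: "real \<Rightarrow> 'a::real_inner"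
  assumes "real_analytic_on f I"
  shows "real_analytic_on (\<lambda>s. f s \<bullet> u) I"
  unfolding real_analytic_on_def
proof
  fix s0 assume "s0 \<in> I"
  then obtain r a where "r > 0"
    and a: "\<forall>s\<in>I. \<bar>s - s0\<bar> < r \<longrightarrow> (\<lambda>n. (s - s0) ^ n *\<^sub>R a n) sums f s"
    using assms unfolding real_analytic_on_def by blast
  have "(\<lambda>n. (s - s0) ^ n *\<^sub>R (a n \<bullet> u)) sums (f s \<bullet> u)" if "s \<in> I" "\<bar>s - s0\<bar> < r" for s
    using bounded_linear.sums[OF bounded_linear_inner_left a[rule_format, OF that], of u] by simp
  then show "\<exists>r>0. \<exists>a. \<forall>s\<in>I. \<bar>s - s0\<bar> < r \<longrightarrow> (\<lambda>n. (s - s0) ^ n *\<^sub>R a n) sums (f s \<bullet> u)"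
    using \<open>r > 0\<close> by (intro exI[of _ r] conjI exI[of _ "\<lambda>n. a n \<bullet> u"]) auto
qed

section \<open>The identity theorem on an interval\<close>

text \<open>The set \<open>Z\<close> of points near which \<open>f\<close> vanishes is open by
  construction. A point of \<open>I\<close> outside \<open>Z\<close> is at most an isolated zero, so
  it has a neighbourhood missing \<open>Z\<close>. Connectedness then leaves only
  \<open>Z = I\<close>.\<close>

lemma real_analytic_on_eq_zero:
  fixes f :: "real \<Rightarrow> real"
  assumes I: "open I" "connected I" and f: "real_analytic_on f I"
    and s0: "s0 \<in> I" and zero: "\<forall>\<^sub>F s in nhds s0. f s = 0" and s: "s \<in> I"
  shows "f s = 0"
proof -
  define Z where "Z = {s \<in> I. \<forall>\<^sub>F t in nhds s. f t = 0}"
  have Z_eq: "Z = I \<inter> {s. \<forall>\<^sub>F t in nhds s. f t = 0}"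
    by (auto simp: Z_def)
  have "open {s. \<forall>\<^sub>F t in nhds s. f t = 0}"
    unfolding open_subopen[of "{s. \<forall>\<^sub>F t in nhds s. f t = 0}"]
    by (auto simp: eventually_nhds)
  then have Z: "open Z"
    using I(1) by (simp add: Z_eq open_Int)
  have sep: "\<exists>U. open U \<and> t \<in> U \<and> U \<inter> Z = {}" if t: "t \<in> I - Z" for t
  proof -
    obtain r a where r: "r > 0"
      and a: "\<And>x. \<bar>x\<bar> < r \<Longrightarrow> (\<lambda>n. x ^ n *\<^sub>R a n) sums f (t + x)"
      using real_analytic_on_expansion[OF I(1) f, of t] t by (metis DiffD1)
    have a': "(\<lambda>n. a n * (x - t) ^ n) sums f x" if "norm (x - t) < r" for x
      using a[of "x - t"] that by (simp add: mult.commute)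
    have punct: "\<exists>e>0. \<forall>z. z \<noteq> t \<and> dist z t < e \<longrightarrow> f z \<noteq> 0"
    proof (cases "f t = 0")
      case True
      \<comment> \<open>Were all coefficients zero, \<open>f\<close> would vanish near
        \<open>t\<close>, which would put \<open>t\<close> into \<open>Z\<close>.\<close>
      have "\<exists>m. a m \<noteq> 0"
      proof (rule ccontr)
        assume "\<nexists>m. a m \<noteq> 0"
        have "f x = 0" if "dist x t < r" for x
        proof -
          have "(\<lambda>n. 0) sums f x"
            using a'[of x] that \<open>\<nexists>m. a m \<noteq> 0\<close> by (simp add: dist_norm)
          then show ?thesis using sums_unique2 sums_zero by blast
        qed
        then have "\<forall>\<^sub>F x in nhds t. f x = 0"
          using r by (auto simp: eventually_nhds_metric)
        then show False using t by (simp add: Z_def)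
      qed
      then obtain m where m: "a m \<noteq> 0" by blast
      \<comment> \<open>Evaluating the series at its centre gives \<open>a 0 = f t = 0\<close>. The
        nonzero coefficient thus has positive index, as the isolated-zero theorem
        \<open>powser_0_nonzero\<close> demands.\<close>
      have "a 0 = 0"
        using sums_unique2[OF a'[of t] powser_sums_zero[of a, folded diff_self[of t]]] True r
        by simp
      then have "m > 0" using m by (cases m) auto
      obtain e where "e > 0" "\<And>z. z \<in> cball t e - {t} \<Longrightarrow> f z \<noteq> 0"
        using powser_0_nonzero[of r t a f, OF r a' True m \<open>m > 0\<close>] by blast
      then show ?thesis
        by (intro exI[of _ e]) (auto simp: dist_commute)
    next
      case False
      have "isCont f t"
        using real_analytic_on_has_vector_derivative[OF I(1) f] t
          has_vector_derivative_continuous by blast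
      then have "\<forall>\<^sub>F z in at t. f z \<noteq> 0"
        using False by (simp add: isCont_def tendsto_imp_eventually_ne)
      then show ?thesis
        by (auto simp: eventually_at)
    qed
    then obtain e where e: "e > 0" "\<And>z. z \<noteq> t \<Longrightarrow> dist z t < e \<Longrightarrow> f z \<noteq> 0"
      by blast
    have "ball t e \<inter> Z = {}"
    proof -
      have "z \<notin> Z" if "z \<in> ball t e" for z
      proof (cases "z = t")
        case False
        then have "f z \<noteq> 0" using e that by (simp add: dist_commute)
        then show ?thesis by (auto simp: Z_def dest: eventually_nhds_x_imp_x)
      qed (use t in auto)
      then show ?thesis by blast
    qed
    then show ?thesis using e(1) by (intro exI[of _ "ball t e"]) auto
  qed
  \<comment> \<open>\<open>W\<close> is the largest open set disjoint from \<open>Z\<close>;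
    together they cover \<open>I\<close>, and \<open>s0\<close> lies in \<open>Z\<close>.\<close>
  define W where "W = \<Union>{U. open U \<and> U \<inter> Z = {}}"
  have "open W" "Z \<inter> W = {}"
    by (auto simp: W_def)
  moreover have "I \<subseteq> Z \<union> W"
    using sep unfolding W_def by blast
  moreover have "s0 \<in> Z"
    using s0 zero by (simp add: Z_def)
  ultimately have "I \<subseteq> Z"
    using connectedD[OF I(2) Z, of W] s0 by blast
  then show ?thesis
    using s by (auto simp: Z_def dest: eventually_nhds_x_imp_x)
qed

section \<open>Vanishing determinant and a fixed orthogonal direction\<close>

text \<open>If \<open>f'\<close> is parallel to \<open>f\<close>, only the length of
  \<open>f\<close> can vary. Dividing \<open>f\<close> by its component \<open>h\<close> along
  \<open>f s0\<close>, nonzero near \<open>s0\<close>, therefore leaves a constant vector. The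
  factor \<open>k\<close> is kept nonzero so that it can be cancelled later.\<close>

lemma cross_self_derivative_zero_imp_fixed_direction:
  fixes f f' :: "real \<Rightarrow> real^3"
  assumes J: "open J" "s0 \<in> J" and nz: "f s0 \<noteq> 0"
    and der: "\<And>s. s \<in> J \<Longrightarrow> (f has_vector_derivative f' s) (at s)"
    and par: "\<And>s. s \<in> J \<Longrightarrow> f s \<times> f' s = 0"
  shows "\<forall>\<^sub>F s in nhds s0. \<exists>k. k \<noteq> 0 \<and> f s = k *\<^sub>R f s0"
proof -
  define h where "h s = f s \<bullet> f s0" for s
  have "isCont f s0"
    using der[OF J(2)] has_vector_derivative_continuous by blast
  then have "isCont h s0"
    unfolding h_def by (intro continuous_intros)
  moreover have "h s0 \<noteq> 0" using nz by (simp add: h_def)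
  ultimately have "\<forall>\<^sub>F s in at s0. h s \<noteq> 0"
    by (simp add: isCont_def tendsto_imp_eventually_ne)
  then have "\<forall>\<^sub>F s in nhds s0. h s \<noteq> 0 \<and> s \<in> J"
    using \<open>h s0 \<noteq> 0\<close> J eventually_nhds_in_open[OF J]
    by (auto simp: eventually_at_filter elim: eventually_elim2)
  then obtain e where e: "e > 0" "\<And>s. s \<in> ball s0 e \<Longrightarrow> h s \<noteq> 0 \<and> s \<in> J"
    by (auto simp: eventually_nhds_metric dist_commute)
  have "((\<lambda>s. inverse (h s) *\<^sub>R f s) has_vector_derivative 0) (at s within ball s0 e)"
    if "s \<in> ball s0 e" for s
  proof -
    have hs: "h s \<noteq> 0" "s \<in> J" using e that by auto
    have dh: "(h has_real_derivative f' s \<bullet> f s0) (at s)"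
      unfolding h_def has_real_derivative_iff_has_vector_derivative
      by (rule bounded_linear.has_vector_derivative[OF bounded_linear_inner_left der[OF hs(2)]])
    \<comment> \<open>The numerator of the derivative of \<open>f / h\<close> is, up to sign, this triple product.\<close>
    have "f s0 \<times> (f s \<times> f' s) = (f' s \<bullet> f s0) *\<^sub>R f s - h s *\<^sub>R f' s"
      by (simp add: h_def Lagrange inner_commute)
    then have eq: "h s *\<^sub>R f' s = (f' s \<bullet> f s0) *\<^sub>R f s"
      using par[OF hs(2)] by simp
    have "((\<lambda>s. inverse (h s) *\<^sub>R f s) has_vector_derivative
        inverse (h s) *\<^sub>R f' s + (- (inverse (h s) * (f' s \<bullet> f s0) * inverse (h s))) *\<^sub>R f s) (at s)"
      by (rule has_vector_derivative_scaleR[OF DERIV_inverse'[OF dh hs(1)] der[OF hs(2)]])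
    moreover have "inverse (h s) *\<^sub>R f' s =
        (inverse (h s) * (f' s \<bullet> f s0) * inverse (h s)) *\<^sub>R f s"
    proof -
      \<comment> \<open>The factor \<open>h s\<close> is inserted so that \<open>eq\<close> can
        trade \<open>f' s\<close> for a multiple of \<open>f s\<close>; the two terms of the product
        rule then cancel.\<close>
      have "inverse (h s) *\<^sub>R f' s = (inverse (h s) * inverse (h s)) *\<^sub>R (h s *\<^sub>R f' s)"
        using hs by simp
      then show ?thesis by (simp add: eq mult_ac)
    qed
    ultimately show ?thesis
      by (simp add: has_vector_derivative_at_within)
  qed
  then obtain c where c: "\<And>s. s \<in> ball s0 e \<Longrightarrow> inverse (h s) *\<^sub>R f s = c"
    using has_vector_derivative_zero_constant[of "ball s0 e"] convex_ball by blast
  have "\<exists>k. k \<noteq> 0 \<and> f s = k *\<^sub>R f s0" if "s \<in> ball s0 e" for s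
  proof -
    have "inverse (h s) *\<^sub>R f s = inverse (h s0) *\<^sub>R f s0"
      using c that e(1) by simp
    then have "h s *\<^sub>R (inverse (h s) *\<^sub>R f s) = (h s * inverse (h s0)) *\<^sub>R f s0"
      by simp
    then have "f s = (h s * inverse (h s0)) *\<^sub>R f s0"
      using e(2)[OF that] by simp
    then show ?thesis using e that by (intro exI[of _ "h s * inverse (h s0)"]) auto
  qed
  then show ?thesis
    using e(1) by (auto simp: eventually_nhds_metric dist_commute)
qed

lemma exists_unit_orthogonal_of_det_zero:
  fixes N :: "real \<Rightarrow> real^3"
  assumes I: "open I" "connected I" and N: "real_analytic_on N I"
    and nz: "\<exists>s\<in>I. N s \<noteq> 0"
    and det0: "\<And>s. s \<in> I \<Longrightarrow> det (vector [N s, vderiv N s, vderiv (vderiv N) s] :: real^3^3) = 0"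
  obtains u where "norm u = 1" "\<And>s. s \<in> I \<Longrightarrow> N s \<bullet> u = 0"
proof -
  define M where "M s = N s \<times> vderiv N s" for s
  note dN = real_analytic_on_has_vector_derivative[OF I(1) N]
  note dN' = real_analytic_on_has_vector_derivative[OF I(1) real_analytic_on_vderiv[OF I(1) N]]
  have "\<exists>s0\<in>I. \<exists>u. u \<noteq> 0 \<and> (\<forall>\<^sub>F s in nhds s0. N s \<bullet> u = 0)"
  proof (cases "\<exists>s0\<in>I. M s0 \<noteq> 0")
    case True
    then obtain s0 where s0: "s0 \<in> I" "M s0 \<noteq> 0" by blast
    \<comment> \<open>The product rule also yields \<open>N' \<times> N'\<close>, which is
      zero.\<close>
    have dM: "(M has_vector_derivative N s \<times> vderiv (vderiv N) s) (at s)" if "s \<in> I" for s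
    proof -
      have "bounded_bilinear ((\<times>) :: real^3 \<Rightarrow> real^3 \<Rightarrow> real^3)"
        using bilinear_cross by (simp add: bilinear_conv_bounded_bilinear)
      from bounded_bilinear.has_vector_derivative[OF this dN[OF that] dN'[OF that]]
      show ?thesis by (simp add: M_def[abs_def])
    qed
    \<comment> \<open>Expansion gives \<open>det (N, N', N'') N - det (N, N', N) N''\<close>: the
      first determinant vanishes by hypothesis, the second has a repeated row.\<close>
    have "M s \<times> (N s \<times> vderiv (vderiv N) s) = 0" if "s \<in> I" for s
      unfolding M_def cross_cross_det using det0[OF that]
      by (simp add: dot_cross_det[symmetric] dot_cross_self)
    with cross_self_derivative_zero_imp_fixed_direction[OF I(1) s0 dM]
    have "\<forall>\<^sub>F s in nhds s0. \<exists>k. k \<noteq> 0 \<and> M s = k *\<^sub>R M s0"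
      by blast
    then have "\<forall>\<^sub>F s in nhds s0. N s \<bullet> M s0 = 0"
    proof eventually_elim
      case (elim s)
      then obtain k where "k \<noteq> 0" "M s = k *\<^sub>R M s0" by blast
      moreover have "N s \<bullet> M s = 0" by (simp add: M_def dot_cross_self)
      ultimately show ?case by simp
    qed
    then show ?thesis using s0 by blast
  next
    case False
    obtain s0 where s0: "s0 \<in> I" "N s0 \<noteq> 0" using nz by blast
    \<comment> \<open>The witness is a nonzero cross product of \<open>N s0\<close> with a
      coordinate vector.\<close>
    obtain u where u: "u \<noteq> 0" "N s0 \<bullet> u = 0"
      using cross_basis_nonzero[OF s0(2)] dot_cross_self(1) by metis
    have "\<forall>\<^sub>F s in nhds s0. \<exists>k. k \<noteq> 0 \<and> N s = k *\<^sub>R N s0"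
      by (rule cross_self_derivative_zero_imp_fixed_direction[OF I(1) s0 dN])
        (use False in \<open>auto simp: M_def\<close>)
    then have "\<forall>\<^sub>F s in nhds s0. N s \<bullet> u = 0"
      by eventually_elim (use u in auto)
    then show ?thesis using s0 u by blast
  qed
  then obtain s0 u where u: "s0 \<in> I" "u \<noteq> 0" "\<forall>\<^sub>F s in nhds s0. N s \<bullet> u = 0"
    by blast
  \<comment> \<open>The orthogonality known near \<open>s0\<close> spreads to all of
    \<open>I\<close> by the identity theorem.\<close>
  have "N s \<bullet> u = 0" if "s \<in> I" for s
    using real_analytic_on_eq_zero[OF I real_analytic_on_inner[OF N] u(1,3) that] .
  then show thesis
    by (intro that[of "u /\<^sub>R norm u"]) (use u in auto)
qed

section \<open>Helices and the determinant criterion\<close>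

text \<open>The conclusion is again the hypothesis \<open>const\<close>, for the derivative and with
  constant 0, so the lemma can be iterated along successive derivatives.\<close>

lemma inner_vderiv_eq_zero:
  assumes I: "open I" and der: "\<And>s. s \<in> I \<Longrightarrow> (f has_vector_derivative vderiv f s) (at s)"
    and const: "\<And>s. s \<in> I \<Longrightarrow> f s \<bullet> u = c" and s: "s \<in> I"
  shows "vderiv f s \<bullet> u = 0"
proof -
  have "((\<lambda>s. f s \<bullet> u) has_vector_derivative vderiv f s \<bullet> u) (at s)"
    by (rule bounded_linear.has_vector_derivative[OF bounded_linear_inner_left der[OF s]])
  moreover have "((\<lambda>s. f s \<bullet> u) has_vector_derivative 0) (at s)"
    using has_vector_derivative_const[of c "at s"]
    by (rule has_vector_derivative_transform_within_open[OF _ I s]) (simp add: const)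
  ultimately show ?thesis by (rule vector_derivative_unique_at)
qed

text \<open>Since \<open>b\<close> and \<open>c\<close> are orthogonal to \<open>u\<close>, their
  cross product is parallel to \<open>u\<close>. Expanding
  \<open>a \<times> ((b \<times> c) \<times> u)\<close> then leaves the determinant times
  \<open>u\<close>, up to sign.\<close>

lemma det_vector_eq_zero_of_orthogonal:
  fixes a b c u :: "real^3"
  assumes "u \<noteq> 0" "a \<bullet> u = 0" "b \<bullet> u = 0" "c \<bullet> u = 0"
  shows "det (vector [a, b, c] :: real^3^3) = 0"
proof -
  have "(b \<times> c) \<times> u = 0"
    using assms by (simp add: cross_skew[of "b \<times> c" u] Lagrange inner_commute)
  then have "a \<times> ((b \<times> c) \<times> u) = 0" by simp
  then have "(a \<bullet> (b \<times> c)) *\<^sub>R u = 0"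
    using assms by (simp add: Lagrange)
  then show ?thesis using assms by (simp add: dot_cross_det)
qed

theorem theorem3p4:
  fixes I :: "real set" and \<psi> T :: "real \<Rightarrow> real^3"
  assumes "open I" and "is_interval I" and "I \<noteq> {}"
    and "real_analytic_on \<psi> I"
    and "unit_speed_on \<psi> I"
    and "\<exists>s\<in>I. curvature \<psi> s \<noteq> 0"
    and "T = tangent \<psi>"
  shows "general_helix_on \<psi> I \<longleftrightarrow>
    (\<forall>s\<in>I. det (vector [vderiv T s, vderiv (vderiv T) s,
                          vderiv (vderiv (vderiv T)) s] :: real^3^3) = 0)"
proof
  note I = \<open>open I\<close>
  have anT: "real_analytic_on T I"
    using assms real_analytic_on_vderiv by (auto simp: tangent_def)
  note anN = real_analytic_on_vderiv[OF I anT]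
  note anN' = real_analytic_on_vderiv[OF I anN]
  note der = real_analytic_on_has_vector_derivative[OF I]
  {
    assume "general_helix_on \<psi> I"
    then obtain u c where u: "norm u = 1" and c: "\<And>s. s \<in> I \<Longrightarrow> T s \<bullet> u = c"
      using assms(7) unfolding general_helix_on_def by blast
    \<comment> \<open>Three applications place \<open>T'\<close>, \<open>T''\<close> and
      \<open>T'''\<close> in the plane orthogonal to \<open>u\<close>.\<close>
    note N0 = inner_vderiv_eq_zero[OF I der[OF anT] c]
    note N1 = inner_vderiv_eq_zero[OF I der[OF anN] N0]
    note N2 = inner_vderiv_eq_zero[OF I der[OF anN'] N1]
    show "\<forall>s\<in>I. det (vector [vderiv T s, vderiv (vderiv T) s,
        vderiv (vderiv (vderiv T)) s] :: real^3^3) = 0"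
      using u N0 N1 N2 by (auto intro!: det_vector_eq_zero_of_orthogonal[of u])
  next
    assume det0: "\<forall>s\<in>I. det (vector [vderiv T s, vderiv (vderiv T) s,
        vderiv (vderiv (vderiv T)) s] :: real^3^3) = 0"
    have conn: "connected I"
      using assms(2) by (simp add: is_interval_connected)
    have "\<exists>s\<in>I. vderiv T s \<noteq> 0"
      using assms(6,7) by (auto simp: curvature_def tangent_def)
    then obtain u where u: "norm u = 1" "\<And>s. s \<in> I \<Longrightarrow> vderiv T s \<bullet> u = 0"
      using exists_unit_orthogonal_of_det_zero[OF I conn anN] det0 by blast
    \<comment> \<open>The derivative of \<open>T \<bullet> u\<close> is
      \<open>T' \<bullet> u = 0\<close>, so it is constant on the convex set
      \<open>I\<close>.\<close>
    have "((\<lambda>s. T s \<bullet> u) has_vector_derivative 0) (at s within I)" if "s \<in> I" for s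
      using bounded_linear.has_vector_derivative[OF bounded_linear_inner_left der[OF anT that], of u]
        u(2)[OF that] by (simp add: has_vector_derivative_at_within)
    then obtain c where "\<And>s. s \<in> I \<Longrightarrow> T s \<bullet> u = c"
      using has_vector_derivative_zero_constant[of I "\<lambda>s. T s \<bullet> u"]
        is_interval_convex[OF assms(2)] by blast
    then show "general_helix_on \<psi> I"
      unfolding general_helix_on_def using u(1) assms(7) by blast
  }
qed

end
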